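(* Let $X,Y$ be $F$-spaces, with $Y$ separable, let $\Lambda\subset\mathbb R^d$ be bounded and let $\mathcal T_\lambda=(T_{\lambda,n})_{n\in\mathbb N_0}$, $\lambda\in\Lambda$, be sequences of continuous linear operators from $X$ to $Y$. Assume that there exist a dense subset $Y_0$ of $Y$ and mappings $S_{\lambda,n}:Y_0\to X$, $\lambda\in\Lambda$, $n\in\mathbb N_0$, such that for every $u\in Y_0$: (1) the series $\sum_{n\ge0}T_{\lambda,m}(S_{\mu,m+n}(u))$ converges unconditionally, uniformly for $m\in\mathbb N_0$ and $\lambda,\mu\in\Lambda$; (2) the series $\sum_{0\le n\le m}T_{\lambda,m}(S_{\mu,m-n}(u))$ converges unconditionally, uniformly for $m\in\mathbb N_0$ and $\lambda,\mu\in\Lambda$; (3) the series $\sum_{n\ge0}S_{\lambda,n}(u)$ converges unconditionally, uniformly for $\lambda\in\Lambda$; (4) for every $\varepsilon>0$, there exist $\delta>0$ and $M\in\mathbb N$ such that for every $n\ge M$ and every $\lambda,\mu\in\Lambda$, $$\|\lambda-\mu\|_\infty\le\delta\ \Longrightarrow\ \|T_{\lambda,n}(S_{\mu,n}(u))-u\|\le\varepsilon .$$ Then the family $\{\mathcal T_\lambda:\lambda\in\Lambda\}$ admits a common frequently universal vector.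
   Context: $\|\cdot\|$ denotes an $F$-norm defining the topology of $X$ or of $Y$. Series $\sum_{n\ge0}x_n^{(\alpha)}$ indexed by parameters $\alpha$ converge unconditionally, uniformly in $\alpha$, if for every $\varepsilon>0$ there is $N\in\mathbb N$ such that $\|\sum_{n\in F}x_n^{(\alpha)}\|<\varepsilon$ for every finite set $F\subset\{N,N+1,\dots\}$ and every $\alpha$; in (2) the terms with $n>m$ are taken to be $0$. For $A\subset\mathbb N_0$, $\underline d(A)=\liminf_{n\to\infty}\frac{\#(A\cap[0,n])}{n+1}$. A vector $x\in X$ is frequently universal for a sequence $(T_n)_{n\in\mathbb N_0}$ of operators from $X$ to $Y$ if $\underline d(\{n\in\mathbb N_0:T_nx\in U\})>0$ for every non-empty open $U\subset Y$; it is a common frequently universal vector for $\{\mathcal T_\lambda\}$ if it is frequently universal for each $\mathcal T_\lambda$. *)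

theory Defs
  imports "HOL-Analysis.Analysis"
begin

text \<open>
  The scalars range over an arbitrary \<^class>\<open>real_normed_field\<close>. Up to isomorphism
  the only ones are the real and the complex numbers, so this is the usual convention that
  the scalar field is one of these two.
\<close>

locale F_norm = vector_space scale
  for scale :: "'k::real_normed_field \<Rightarrow> 'a::ab_group_add \<Rightarrow> 'a" +
  fixes N :: "'a \<Rightarrow> real"
  assumes F_norm_nonneg: "0 \<le> N x"
    and F_norm_triangle: "N (x + y) \<le> N x + N y"
    and F_norm_scale_le: "norm c \<le> 1 \<Longrightarrow> N (scale c x) \<le> N x"
    and F_norm_scale_tendsto: "((\<lambda>c. N (scale c x)) \<longlongrightarrow> 0) (at 0)"
    and F_norm_eq_0D: "N x = 0 \<Longrightarrow> x = 0"
begin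

lemma F_norm_zero: "N 0 = 0"
proof -
  have "((\<lambda>c::'k. N 0) \<longlongrightarrow> 0) (at 0)"
    using F_norm_scale_tendsto[of 0] by simp
  then show ?thesis
    by (simp add: tendsto_const_iff)
qed

lemma F_norm_minus: "N (- x) = N x"
proof -
  have le: "N (- y) \<le> N y" for y
    using F_norm_scale_le[of "- 1" y] by simp
  show ?thesis
    using le[of x] le[of "- x"] by simp
qed

sublocale Metric_space UNIV "\<lambda>x y. N (x - y)"
proof
  fix x y z :: 'a
  show "0 \<le> N (x - y)" by (rule F_norm_nonneg)
  show "N (x - y) = N (y - x)" using F_norm_minus[of "x - y"] by simp
  show "N (x - y) = 0 \<longleftrightarrow> x = y" using F_norm_eq_0D[of "x - y"] F_norm_zero by auto
  show "N (x - z) \<le> N (x - y) + N (y - z)" using F_norm_triangle[of "x - y" "y - z"] by simp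
qed

end

text \<open>
  An F-space, together with a chosen F-norm \<open>N\<close> that induces its topology (the type class
  topology of \<^typ>\<open>'a\<close>) and for which it is complete.
\<close>

locale F_space = F_norm scale N
  for scale :: "'k::real_normed_field \<Rightarrow> 'a::{ab_group_add, topological_space} \<Rightarrow> 'a"
    and N :: "'a \<Rightarrow> real" +
  assumes mtopology_eq_euclidean: "mtopology = euclidean"
    and mcomplete: "mcomplete"

text \<open>
  The series with terms \<open>x \<alpha> n\<close> (\<open>n \<ge> 0\<close>) converge unconditionally, uniformly for \<open>\<alpha> \<in> I\<close>.
\<close>

definition uniformly_unconditionally_convergent ::
    "('a::ab_group_add \<Rightarrow> real) \<Rightarrow> 'i set \<Rightarrow> ('i \<Rightarrow> nat \<Rightarrow> 'a) \<Rightarrow> bool" where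
  "uniformly_unconditionally_convergent N I x \<longleftrightarrow>
     (\<forall>\<epsilon>>0. \<exists>n0. \<forall>F. finite F \<and> F \<subseteq> {n0..} \<longrightarrow> (\<forall>\<alpha>\<in>I. N (\<Sum>n\<in>F. x \<alpha> n) < \<epsilon>))"

definition lower_density :: "nat set \<Rightarrow> ereal" where
  "lower_density A = liminf (\<lambda>n. ereal (real (card (A \<inter> {0..n})) / real (n + 1)))"

definition frequently_universal :: "(nat \<Rightarrow> 'a \<Rightarrow> 'b::topological_space) \<Rightarrow> 'a \<Rightarrow> bool" where
  "frequently_universal T x \<longleftrightarrow>
     (\<forall>U. open U \<and> U \<noteq> {} \<longrightarrow> lower_density {n. T n x \<in> U} > 0)"

definition common_frequently_universal ::
    "'p set \<Rightarrow> ('p \<Rightarrow> nat \<Rightarrow> 'a \<Rightarrow> 'b::topological_space) \<Rightarrow> 'a \<Rightarrow> bool" where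
  "common_frequently_universal \<Lambda> T x \<longleftrightarrow> (\<forall>p\<in>\<Lambda>. frequently_universal (T p) x)"

end

theory Submission
  imports Defs
begin

text \<open>
  The hypothesis \<open>TS_near_id\<close> is uniform in \<open>n\<close>: for fixed \<open>u\<close> and \<open>\<epsilon>\<close> a single \<open>\<delta>\<close> serves all
  large times. Hence one approximant \<open>S \<mu> n u\<close> handles every parameter within \<open>\<delta>\<close> of
  \<open>\<mu>\<close>, and the uncountably many requirements (every parameter, every open set) reduce to
  countably many tasks. A task is a triple of a point \<open>d i\<close> from a countable dense subset of
  \<open>Y\<close>, a precision \<open>1 / (s + 1)\<close>, and a parameter \<open>\<mu> j\<close> from a countable dense subset of
  \<open>\<Lambda>\<close>; it asks for an orbit that is close to \<open>d i\<close> at many times, for all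
  parameters near \<open>\<mu> j\<close>.

  Countably many tasks are treated as in the frequent hypercyclicity criterion. Task \<open>k\<close>
  contributes a series with terms \<open>\<sigma> k n\<close>, and by the unconditional convergence of the three
  kinds of series its sums over indices beyond some \<open>R k\<close> are small, also after \<open>T\<close> is applied.
  One chooses sets of times of positive lower density, one per task, such that distinct times
  for tasks \<open>k\<close> and \<open>l\<close> are at least \<open>max (R k) (R l)\<close> apart
  (\<open>separated_sets_of_positive_lower_density\<close>), and lets \<open>x\<close> be the sum of
  \<open>\<sigma> k n\<close> over all tasks \<open>k\<close> and all times \<open>n\<close> of task \<open>k\<close>. At a time \<open>m\<close>
  of task \<open>k\<close> the separation makes the joint effect of all other terms at most
  \<open>4 * (1/2) ^ k\<close> (\<open>exists_frequently_shadowing_vector\<close>), so the orbit of \<open>x\<close> under the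
  parameter \<open>l\<close> follows \<open>T l m (\<sigma> k m)\<close>. If \<open>l\<close> is near \<open>\<mu> j\<close>, this is close to a point
  of \<open>Y0\<close> near \<open>d i\<close> by \<open>TS_near_id\<close>. An open set contains a
  ball, and refining the precision \<open>s\<close> also forces \<open>k \<ge> s\<close>; thus both errors
  become as small as required.
\<close>

section \<open>Separated sets of positive lower density\<close>

lemma lower_density_mono:
  assumes "A \<subseteq> B"
  shows "lower_density A \<le> lower_density B"
  unfolding lower_density_def
proof (intro Liminf_mono always_eventually allI)
  fix n
  have "card (A \<inter> {0..n}) \<le> card (B \<inter> {0..n})"
    using assms by (intro card_mono) auto
  then show "ereal (real (card (A \<inter> {0..n})) / real (n + 1))
      \<le> ereal (real (card (B \<inter> {0..n})) / real (n + 1))"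
    by (simp add: divide_right_mono)
qed

lemma lower_density_range_linear_growth:
  fixes g :: "nat \<Rightarrow> nat"
  assumes "inj g" and growth: "\<And>i. g i \<le> C * Suc i" and "C > 0"
  shows "lower_density (range g) > 0"
proof -
  have count: "n div C \<le> card (range g \<inter> {0..n})" for n
  proof -
    have "g i \<le> n" if "i < n div C" for i
    proof -
      have "C * Suc i \<le> C * (n div C)" using that by (intro mult_le_mono2) simp
      then show ?thesis using growth[of i] times_div_less_eq_dividend[of C n] by linarith
    qed
    then have "g ` {..<n div C} \<subseteq> range g \<inter> {0..n}" by auto
    then have "card (g ` {..<n div C}) \<le> card (range g \<inter> {0..n})"
      by (intro card_mono) auto
    then show ?thesis
      using card_image[of g "{..<n div C}"] \<open>inj g\<close> by (simp add: inj_on_subset)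
  qed
  have bound: "1 / (2 * real C) \<le> real (card (range g \<inter> {0..n})) / real (n + 1)"
    if "n \<ge> 2 * C" for n
  proof -
    have "n < C * Suc (n div C)"
      using \<open>C > 0\<close> by (metis dividend_less_times_div mult_Suc_right)
    then have "n + 1 \<le> C * (n div C) + C" by simp
    moreover have "n div C \<ge> 2" using that \<open>C > 0\<close>
      by (simp add: less_eq_div_iff_mult_less_eq)
    then have "2 * C \<le> C * (n div C)" by simp
    ultimately have "n + 1 \<le> 2 * (C * (n div C))" by linarith
    also have "\<dots> \<le> 2 * (C * card (range g \<inter> {0..n}))"
      using count by simp
    finally have "real (n + 1) \<le> real (2 * (C * card (range g \<inter> {0..n})))"
      by (simp only: of_nat_le_iff)
    then show ?thesis using \<open>C > 0\<close> by (simp add: field_simps)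
  qed
  have "ereal (1 / (2 * real C)) \<le> lower_density (range g)"
    unfolding lower_density_def
    by (rule Liminf_bounded, rule eventually_sequentiallyI[of "2 * C"]) (use bound in simp)
  then show ?thesis
    using \<open>C > 0\<close> by (metis ereal_less(2) less_le_trans of_nat_0_less_iff zero_less_divide_1_iff zero_less_mult_iff zero_less_numeral)
qed

lemma sum_half_powers_le: "(\<Sum>k<n. (1/2::real)^k) \<le> 2"
  by (induction n) (auto simp: sum_gp_strict)

text \<open>
  The sets cannot be unions of arithmetic progressions: every gap of the \<open>k\<close>th set around a
  point of the \<open>l\<close>th one must be at least \<open>N l\<close>, which may be unbounded in \<open>l\<close>. So the
  classes are first formed without regard to separation, as the odd multiples of a power
  \<open>q k\<close> of two, and then stretched apart by a map \<open>f\<close> which inserts a gap of length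
  \<open>N k\<close> before and after each multiple of \<open>q k\<close>. Since \<open>q k \<ge> 2 ^ k * N k\<close>, the
  inserted gaps have bounded average length, so \<open>f\<close> grows linearly and the stretched classes
  keep positive lower density. All the sets are returned at once, as a set \<open>B\<close> of times with a
  colouring \<open>\<kappa>\<close>.
\<close>

lemma separated_sets_of_positive_lower_density:
  fixes N :: "nat \<Rightarrow> nat"
  obtains B :: "nat set" and \<kappa> :: "nat \<Rightarrow> nat" where
    "\<And>k. lower_density {n\<in>B. \<kappa> n = k} > 0"
    "\<And>n. n \<in> B \<Longrightarrow> N (\<kappa> n) \<le> n"
    "\<And>m n. m \<in> B \<Longrightarrow> n \<in> B \<Longrightarrow> m < n \<Longrightarrow> N (\<kappa> m) \<le> n - m \<and> N (\<kappa> n) \<le> n - m"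
proof -
  define a where "a k = (\<Sum>j\<le>k. Suc (N j))" for k
  define q where "q k = (2::nat) ^ a k" for k
  \<comment> \<open>The quotient of \<open>t\<close> jumps on arriving at a multiple of \<open>q k\<close>, that of \<open>t - 1\<close>
    on leaving it. Only \<open>k < t\<close> can contribute to \<open>f t\<close>, because \<open>q k > k\<close>.\<close>
  define c where "c k t = N k * (t div q k + (t - 1) div q k)" for k t
  define f where "f t = t + (\<Sum>k<t. c k t)" for t
  define e where "e k i = f (q k * (2 * i + 1))" for k i
  have a_ge: "k + N k \<le> a k" for k
  proof -
    have "a k = Suc (N k) + (\<Sum>j<k. Suc (N j))"
      by (simp add: a_def lessThan_Suc_atMost[symmetric])
    moreover have "(\<Sum>j<k. Suc (N j)) \<ge> (\<Sum>j<k. 1)" by (intro sum_mono) auto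
    ultimately show ?thesis by simp
  qed
  have a_less: "a k < a l" if "k < l" for k l
    using that by (rule strict_monoD[rotated]) (simp add: strict_mono_Suc_iff a_def)
  have q_ge: "2 ^ k * N k \<le> q k" for k
  proof -
    have "2 ^ k * N k \<le> 2 ^ k * 2 ^ N k" by (simp add: less_imp_le)
    also have "\<dots> \<le> q k" using a_ge[of k] unfolding q_def power_add[symmetric]
      by (intro power_increasing) auto
    finally show ?thesis .
  qed
  have q_pos: "q k > 0" for k by (simp add: q_def)
  have q_gt: "k < q k" for k
  proof -
    have "k < 2 ^ k" by simp
    also have "\<dots> \<le> q k" unfolding q_def using a_ge[of k] by (intro power_increasing) auto
    finally show ?thesis .
  qed
  have c_mono: "c k s \<le> c k t" if "s \<le> t" for k s t
    unfolding c_def using that by (intro mult_le_mono add_mono div_le_mono) auto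
  have sum_c: "(\<Sum>k<s. c k s) \<le> (\<Sum>k<t. c k s)" if "s \<le> t" for s t
    using that by (intro sum_mono2) auto
  have f_strict: "f s < f t" if "s < t" for s t
  proof -
    have "(\<Sum>k<s. c k s) \<le> (\<Sum>k<t. c k t)"
      using sum_c[of s t] that sum_mono[of "{..<t}" "\<lambda>k. c k s" "\<lambda>k. c k t"] c_mono[of s t]
      by fastforce
    then show ?thesis using that by (simp add: f_def)
  qed
  have f_jump: "f s + N k \<le> f t"
    if "s < t" "0 < s" and dvd: "q k dvd s \<or> q k dvd t" for s t k
  proof -
    have "k < t"
    proof -
      have "q k \<le> s \<or> q k \<le> t" using dvd that by (auto dest: dvd_imp_le)
      then show ?thesis using q_gt[of k] that by linarith
    qed
    have jump: "c k s + N k \<le> c k t"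
    proof -
      have "s div q k + (s - 1) div q k + 1 \<le> t div q k + (t - 1) div q k"
        using dvd
      proof
        assume "q k dvd s"
        then obtain r where r: "s = q k * r" by (elim dvdE)
        with that have "r > 0" by (cases r) auto
        have "(s - 1) div q k < r"
          using r q_pos[of k] \<open>0 < s\<close> by (intro less_mult_imp_div_less) (simp add: mult.commute)
        moreover have "r \<le> (t - 1) div q k"
          using r q_pos[of k] \<open>s < t\<close> by (simp add: less_eq_div_iff_mult_less_eq mult.commute)
        moreover have "s div q k \<le> t div q k" using that by (intro div_le_mono) auto
        ultimately show ?thesis by linarith
      next
        assume "q k dvd t"
        then obtain r where r: "t = q k * r" by (elim dvdE)
        have "s div q k < r"
          using r q_pos[of k] \<open>s < t\<close> by (intro less_mult_imp_div_less) (simp add: mult.commute)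
        moreover have "t div q k = r" using r q_pos[of k] by simp
        moreover have "(s - 1) div q k \<le> (t - 1) div q k" using that by (intro div_le_mono) auto
        ultimately show ?thesis by linarith
      qed
      then have "N k * (s div q k + (s - 1) div q k + 1)
          \<le> N k * (t div q k + (t - 1) div q k)"
        by (rule mult_le_mono2)
      then show ?thesis by (simp add: c_def algebra_simps)
    qed
    have "(\<Sum>j<s. c j s) + N k \<le> (\<Sum>j<t. c j s) + N k" using sum_c[of s t] that by simp
    also have "\<dots> = (\<Sum>j\<in>{..<t} - {k}. c j s) + (c k s + N k)"
      using \<open>k < t\<close> by (simp add: sum.remove[of "{..<t}" k])
    also have "\<dots> \<le> (\<Sum>j\<in>{..<t} - {k}. c j t) + c k t"
      using jump that by (intro add_mono sum_mono c_mono) auto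
    also have "\<dots> = (\<Sum>j<t. c j t)"
      using \<open>k < t\<close> by (simp add: sum.remove[of "{..<t}" k])
    finally show ?thesis using that by (simp add: f_def)
  qed
  have f_le: "f t \<le> 5 * t" for t
  proof -
    have c_le: "real (c k t) \<le> 2 * real t * (1/2)^k" for k
    proof -
      have "c k t \<le> N k * (2 * (t div q k))"
        unfolding c_def using div_le_mono[of "t - 1" t "q k"] by (intro mult_le_mono2) linarith
      then have "2 ^ k * c k t \<le> 2 ^ k * (N k * (2 * (t div q k)))" by simp
      also have "\<dots> = (2 ^ k * N k) * (2 * (t div q k))" by (simp only: mult.assoc)
      also have "\<dots> \<le> q k * (2 * (t div q k))" using q_ge by (rule mult_le_mono1)
      also have "\<dots> \<le> 2 * t" using times_div_less_eq_dividend[of "q k" t] by simp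
      finally have "real (2 ^ k * c k t) \<le> real (2 * t)" by (simp only: of_nat_le_iff)
      then show ?thesis by (simp add: field_simps power_divide)
    qed
    have "real (\<Sum>k<t. c k t) \<le> (\<Sum>k<t. 2 * real t * (1/2)^k)"
      unfolding of_nat_sum by (intro sum_mono c_le)
    also have "\<dots> = 2 * real t * (\<Sum>k<t. (1/2)^k)" by (simp add: sum_distrib_left)
    also have "\<dots> \<le> 2 * real t * 2" by (intro mult_left_mono sum_half_powers_le) auto
    finally have "(\<Sum>k<t. c k t) \<le> 4 * t" by linarith
    then show ?thesis by (simp add: f_def)
  qed
  \<comment> \<open>The exponent \<open>a k\<close> is the exact power of two in an odd multiple of \<open>q k\<close>.\<close>
  have inj_pos: "k = l \<and> i = j" if eq: "q k * (2 * i + 1) = q l * (2 * j + 1)" for k l i j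
  proof -
    have no: False if less: "k < l" and eq: "q k * (2 * i + 1) = q l * (2 * j + 1)" for k l i j
    proof -
      have "2 * q k dvd q l"
        using le_imp_power_dvd[of "Suc (a k)" "a l" "2::nat"] a_less[OF less]
        by (simp add: q_def)
      then have "q k * 2 dvd q k * (2 * i + 1)"
        unfolding eq by (metis dvd_mult2 mult.commute)
      then have "2 dvd 2 * i + 1" using q_pos[of k] by (rule dvd_mult_cancel)
      then show False by simp
    qed
    have "k = l" using no[of k l i j] no[of l k j i] eq by (metis linorder_neqE_nat)
    then show ?thesis using eq q_pos[of k] by simp
  qed
  have f_inj: "s = t" if "f s = f t" for s t
    using that f_strict[of s t] f_strict[of t s] by (metis less_irrefl linorder_neqE_nat)
  have e_inj: "inj (case_prod e)"
  proof (rule injI, clarify)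
    fix k i l j assume "e k i = e l j"
    then show "k = l \<and> i = j" unfolding e_def by (rule inj_pos[OF f_inj])
  qed
  define B where "B = range (case_prod e)"
  define \<kappa> where "\<kappa> = fst \<circ> inv (case_prod e)"
  have \<kappa>_e: "\<kappa> (e k i) = k" for k i
    using inv_f_f[OF e_inj, of "(k, i)"] by (simp add: \<kappa>_def)
  have B_E: "\<exists>k i. n = e k i" if "n \<in> B" for n
    using that by (auto simp: B_def)
  show thesis
  proof (rule that[of B \<kappa>])
    fix k
    have "inj (e k)"
      by (rule injI) (use injD[OF e_inj, of "(k, _)" "(k, _)"] in simp)
    moreover have "e k i \<le> 10 * q k * Suc i" for i
      using f_le[of "q k * (2 * i + 1)"] by (simp add: e_def algebra_simps)
    ultimately have "lower_density (range (e k)) > 0"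
      using q_pos[of k] by (intro lower_density_range_linear_growth[where C = "10 * q k"]) auto
    also have "lower_density (range (e k)) \<le> lower_density {n \<in> B. \<kappa> n = k}"
      by (rule lower_density_mono) (auto simp: B_def \<kappa>_e)
    finally show "lower_density {n \<in> B. \<kappa> n = k} > 0" .
  next
    fix n assume "n \<in> B"
    then obtain k i where n: "n = e k i" using B_E by blast
    define t where "t = q k * (2 * i + 1)"
    have "N k \<le> 2 ^ k * N k" by simp
    also have "\<dots> \<le> q k" by (rule q_ge)
    also have "\<dots> \<le> t" by (simp add: t_def)
    also have "\<dots> \<le> f t" by (simp add: f_def)
    finally have "N k \<le> e k i" by (simp only: e_def t_def)
    then show "N (\<kappa> n) \<le> n" by (simp only: n \<kappa>_e)
  next
    fix m n assume "m \<in> B" "n \<in> B" "m < n"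
    then obtain k i l j where mn: "m = e k i" "n = e l j" using B_E by blast
    define s where "s = q k * (2 * i + 1)"
    define t where "t = q l * (2 * j + 1)"
    have mn': "m = f s" "n = f t" by (auto simp: mn e_def s_def t_def)
    with \<open>m < n\<close> have "s < t" using f_strict[of t s] by (metis less_asym less_irrefl linorder_neqE_nat)
    moreover have "0 < s" using q_pos[of k] by (simp add: s_def)
    moreover have "q k dvd s" "q l dvd t" by (auto simp: s_def t_def)
    ultimately have "m + N k \<le> n" "m + N l \<le> n" using f_jump mn' by auto
    then show "N (\<kappa> m) \<le> n - m \<and> N (\<kappa> n) \<le> n - m" by (auto simp: mn \<kappa>_e)
  qed
qed

section \<open>Superposition of countably many series\<close>

text \<open>
  At stage \<open>K\<close> a series with index \<open>k \<le> K\<close> contributes at most the weight of \<open>K\<close>, a later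
  one at most its own weight. There are \<open>K + 1\<close> series of the first kind; the denominator of the
  weight compensates for their number.
\<close>

lemma sum_max_weights_le:
  assumes "finite P"
  shows "(\<Sum>k\<in>P. (1/2::real) ^ max k K / real (Suc (max k K))) \<le> 2 * (1/2) ^ K"
proof -
  let ?w = "\<lambda>k. (1/2::real) ^ max k K / real (Suc (max k K))"
  obtain L where "P \<subseteq> {..<L}"
    using assms finite_nat_iff_bounded by blast
  then have "sum ?w P \<le> sum ?w {..<Suc K + L}"
    by (intro sum_mono2) auto
  also have "\<dots> \<le> 2 * (1/2) ^ K - (1/2) ^ (K + L)"
  proof (induction L)
    case 0
    have "sum ?w {..<Suc K} = (\<Sum>k<Suc K. (1/2) ^ K / real (Suc K))"
      by (intro sum.cong) (auto simp: max_def)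
    then show ?case by (simp del: of_nat_Suc)
  next
    case (Suc L)
    have "?w (Suc K + L) = (1/2) ^ (K + Suc L) / real (Suc (K + Suc L))"
      by (simp add: max_def)
    also have "\<dots> \<le> (1/2) ^ (K + Suc L) / 1"
      by (intro divide_left_mono) auto
    finally have "?w (Suc K + L) \<le> (1/2) ^ (K + Suc L)" by simp
    moreover have "sum ?w {..<Suc K + Suc L} = sum ?w {..<Suc K + L} + ?w (Suc K + L)"
      by simp
    ultimately have "sum ?w {..<Suc K + Suc L} \<le> 2 * (1/2) ^ K - (1/2) ^ (K + L) + (1/2) ^ (K + Suc L)"
      using Suc.IH by linarith
    then show ?case by simp
  qed
  also have "\<dots> \<le> 2 * (1/2) ^ K" by simp
  finally show ?thesis .
qed

text \<open>
  Restricting or renaming the parameters keeps uniform convergence; this fixes the parameter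
  \<open>\<mu>\<close> of a single task.
\<close>

lemma uniformly_unconditionally_convergent_reindex:
  assumes "uniformly_unconditionally_convergent N I x"
    and "\<And>\<beta>. \<beta> \<in> J \<Longrightarrow> f \<beta> \<in> I" and "\<And>\<beta>. \<beta> \<in> J \<Longrightarrow> y \<beta> = x (f \<beta>)"
  shows "uniformly_unconditionally_convergent N J y"
  using assms unfolding uniformly_unconditionally_convergent_def by metis

text \<open>
  The starting index \<open>r K\<close> controls the first \<open>K + 1\<close> series simultaneously, which is a
  maximum of finitely many indices.
\<close>

lemma uniformly_unconditionally_convergent_starts:
  assumes "\<And>k::nat. uniformly_unconditionally_convergent N I (x k)"
  obtains r :: "nat \<Rightarrow> nat" where
    "\<And>K j F \<alpha>. j \<le> K \<Longrightarrow> finite F \<Longrightarrow> F \<subseteq> {r K..} \<Longrightarrow> \<alpha> \<in> I \<Longrightarrow>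
       N (\<Sum>n\<in>F. x j \<alpha> n) \<le> (1/2) ^ K / real (Suc K)"
proof -
  have "\<exists>n0. \<forall>F. finite F \<and> F \<subseteq> {n0..} \<longrightarrow>
      (\<forall>\<alpha>\<in>I. N (\<Sum>n\<in>F. x j \<alpha> n) < (1/2) ^ K / real (Suc K))" for j K
    using assms[of j] unfolding uniformly_unconditionally_convergent_def
    by (elim allE[of _ "(1/2) ^ K / real (Suc K)"]) auto
  then obtain s where s: "\<And>j K F. finite F \<Longrightarrow> F \<subseteq> {s j K..} \<Longrightarrow>
      (\<forall>\<alpha>\<in>I. N (\<Sum>n\<in>F. x j \<alpha> n) < (1/2) ^ K / real (Suc K))"
    by metis
  show thesis
  proof (rule that[of "\<lambda>K. Max ((\<lambda>j. s j K) ` {..K})"])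
    fix K j :: nat and F \<alpha>
    assume *: "j \<le> K" "finite F" "F \<subseteq> {Max ((\<lambda>j. s j K) ` {..K})..}" "\<alpha> \<in> I"
    have "s j K \<le> Max ((\<lambda>j. s j K) ` {..K})" using *(1) by (intro Max_ge) auto
    with *(3) have "F \<subseteq> {s j K..}" by (meson atLeast_subset_iff order_trans)
    then show "N (\<Sum>n\<in>F. x j \<alpha> n) \<le> (1/2) ^ K / real (Suc K)"
      using s[of F j K] * by (auto intro: less_imp_le)
  qed
qed

context F_norm
begin

lemma F_norm_sum_le: "N (\<Sum>i\<in>A. g i) \<le> (\<Sum>i\<in>A. N (g i))"
proof (induction A rule: infinite_finite_induct)
  case (insert i A)
  then show ?case using F_norm_triangle[of "g i" "sum g A"] by simp
qed (simp_all add: F_norm_zero)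

text \<open>
  Mixed sums, in which the term at \<open>n\<close> is taken from the series with number \<open>\<kappa> n\<close>, stay small
  if each term lies beyond both the start of its own series and the start for stage \<open>K\<close>: the
  block of terms from series \<open>k\<close> then lies beyond \<open>r (max k K)\<close>. The map \<open>h\<close> allows for
  sums indexed by the distance to a fixed time.
\<close>

lemma F_norm_superposition_le:
  fixes r \<kappa> h :: "nat \<Rightarrow> nat"
  assumes tail: "\<And>K j F \<alpha>. j \<le> K \<Longrightarrow> finite F \<Longrightarrow> F \<subseteq> {r K..} \<Longrightarrow> \<alpha> \<in> I \<Longrightarrow>
       N (\<Sum>n\<in>F. x j \<alpha> n) \<le> (1/2) ^ K / real (Suc K)"
    and "finite F" and "inj_on h F" and "\<alpha> \<in> I"
    and far: "\<And>n. n \<in> F \<Longrightarrow> r (\<kappa> n) \<le> h n \<and> r K \<le> h n"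
  shows "N (\<Sum>n\<in>F. x (\<kappa> n) \<alpha> (h n)) \<le> 2 * (1/2) ^ K"
proof -
  define D where "D k = {n \<in> F. \<kappa> n = k}" for k
  have block: "N (\<Sum>n\<in>D k. x (\<kappa> n) \<alpha> (h n)) \<le> (1/2) ^ max k K / real (Suc (max k K))" for k
  proof -
    have "(\<Sum>n\<in>D k. x (\<kappa> n) \<alpha> (h n)) = (\<Sum>n\<in>D k. x k \<alpha> (h n))"
      by (intro sum.cong) (auto simp: D_def)
    also have "\<dots> = (\<Sum>i\<in>h ` D k. x k \<alpha> i)"
      using inj_on_subset[OF \<open>inj_on h F\<close>, of "D k"] by (simp add: sum.reindex D_def)
    also have "N \<dots> \<le> (1/2) ^ max k K / real (Suc (max k K))"
      using far \<open>finite F\<close> \<open>\<alpha> \<in> I\<close> by (intro tail) (auto simp: D_def max_def)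
    finally show ?thesis .
  qed
  have "(\<Sum>n\<in>F. x (\<kappa> n) \<alpha> (h n)) = (\<Sum>k\<in>\<kappa> ` F. \<Sum>n\<in>D k. x (\<kappa> n) \<alpha> (h n))"
    unfolding D_def using \<open>finite F\<close> by (rule sum.image_gen)
  also have "N \<dots> \<le> (\<Sum>k\<in>\<kappa> ` F. N (\<Sum>n\<in>D k. x (\<kappa> n) \<alpha> (h n)))"
    by (rule F_norm_sum_le)
  also have "\<dots> \<le> (\<Sum>k\<in>\<kappa> ` F. (1/2) ^ max k K / real (Suc (max k K)))"
    by (intro sum_mono block)
  also have "\<dots> \<le> 2 * (1/2) ^ K" using \<open>finite F\<close> by (intro sum_max_weights_le) simp
  finally show ?thesis .
qed

end

context F_space
begin

lemma open_contains_F_ball: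
  assumes "open U" and "y \<in> U"
  obtains r where "r > 0" and "\<And>z. N (z - y) < r \<Longrightarrow> z \<in> U"
proof -
  have "openin mtopology U" using assms mtopology_eq_euclidean by simp
  then obtain r where "r > 0" "mball y r \<subseteq> U" using \<open>y \<in> U\<close> by (auto simp: openin_mtopology)
  then show thesis using commute by (intro that[of r]) (auto simp: subset_iff)
qed

lemma open_F_ball: "open {z. N (z - y) < r}"
proof -
  have "openin mtopology (mball y r)" by simp
  moreover have "mball y r = {z. N (z - y) < r}" using commute by auto
  ultimately show ?thesis using mtopology_eq_euclidean by simp
qed

lemma F_norm_limit_le:
  assumes "f \<longlonglongrightarrow> y" and "\<forall>\<^sub>F n in sequentially. N (f n - u) \<le> r"
  shows "N (y - u) \<le> r"
proof -
  have "limitin mtopology f y sequentially" using assms(1) mtopology_eq_euclidean by simp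
  then have "y \<in> mcball u r"
    by (rule limitin_closedin) (use assms(2) commute in \<open>auto elim!: eventually_mono\<close>)
  then show ?thesis using commute[of y u] by auto
qed

lemma unconditional_Cauchy_imp_convergent:
  assumes "\<And>\<epsilon>. \<epsilon> > 0 \<Longrightarrow> \<exists>n0. \<forall>F. finite F \<and> F \<subseteq> B \<inter> {n0..} \<longrightarrow> N (\<Sum>n\<in>F. z n) < \<epsilon>"
  shows "\<exists>x. (\<lambda>J. \<Sum>n\<in>B \<inter> {..<J}. z n) \<longlonglongrightarrow> x"
proof -
  let ?s = "\<lambda>J. \<Sum>n\<in>B \<inter> {..<J}. z n"
  have "MCauchy ?s"
    unfolding MCauchy_def
  proof (intro conjI allI impI)
    fix \<epsilon> :: real assume "\<epsilon> > 0"
    then obtain n0 where n0: "\<And>F. finite F \<Longrightarrow> F \<subseteq> B \<inter> {n0..} \<Longrightarrow> N (\<Sum>n\<in>F. z n) < \<epsilon>"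
      using assms by meson
    have le: "N (?s J' - ?s J) < \<epsilon>" if "n0 \<le> J" "J \<le> J'" for J J'
    proof -
      have "?s J' - ?s J = sum z (B \<inter> {..<J'} - B \<inter> {..<J})"
        using that by (intro sum_diff[symmetric]) auto
      moreover have "B \<inter> {..<J'} - B \<inter> {..<J} \<subseteq> B \<inter> {n0..}" using that by auto
      ultimately show ?thesis using n0 by simp
    qed
    show "\<exists>J. \<forall>n n'. J \<le> n \<longrightarrow> J \<le> n' \<longrightarrow> N (?s n - ?s n') < \<epsilon>"
      by (rule exI[of _ n0]) (use commute le nle_le in metis)
  qed simp
  then show ?thesis using mcomplete mtopology_eq_euclidean by (simp add: mcomplete_def)
qed

end

section \<open>A vector that shadows countably many sequences\<close>

text \<open>
  The frequent hypercyclicity construction, freed from what the sequences \<open>\<sigma> k\<close> are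
  used for: the orbit of \<open>x\<close> behaves, at the times in \<open>A k\<close>, as if \<open>x\<close> were \<open>\<sigma> k n\<close>.
  For \<open>m \<in> A k\<close> the terms of \<open>x\<close> with index above \<open>m\<close> and those below \<open>m\<close> are controlled by
  the two families of series for \<open>T\<close>, at \<open>2 * (1/2) ^ k\<close> each. The bounds \<open>M k\<close> leave room
  for a property of \<open>\<sigma> k n\<close> that holds only for large \<open>n\<close>.
\<close>

lemma exists_frequently_shadowing_vector:
  fixes T :: "'l \<Rightarrow> nat \<Rightarrow> 'a::{ab_group_add, topological_space} \<Rightarrow> 'b::{ab_group_add, topological_space}"
    and \<sigma> :: "nat \<Rightarrow> nat \<Rightarrow> 'a" and M :: "nat \<Rightarrow> nat"
  assumes X: "F_space scaleX normX" and Y: "F_space scaleY normY"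
    and linear: "\<And>l n. l \<in> \<Lambda> \<Longrightarrow> Vector_Spaces.linear scaleX scaleY (T l n)"
    and continuous: "\<And>l n. l \<in> \<Lambda> \<Longrightarrow> continuous_on UNIV (T l n)"
    and plus: "\<And>k. uniformly_unconditionally_convergent normY (UNIV \<times> \<Lambda>)
      (\<lambda>(m, l) n. T l m (\<sigma> k (m + n)))"
    and minus: "\<And>k. uniformly_unconditionally_convergent normY (UNIV \<times> \<Lambda>)
      (\<lambda>(m, l) n. if n \<le> m then T l m (\<sigma> k (m - n)) else 0)"
    and series: "\<And>k. uniformly_unconditionally_convergent normX {()} (\<lambda>_. \<sigma> k)"
  shows "\<exists>x A. \<forall>k. lower_density (A k) > 0 \<and>
    (\<forall>n\<in>A k. M k \<le> n \<and> (\<forall>l\<in>\<Lambda>. normY (T l n x - T l n (\<sigma> k n)) \<le> 4 * (1/2) ^ k))"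
proof -
  interpret X: F_space scaleX normX by (rule X)
  interpret Y: F_space scaleY normY by (rule Y)
  define P where "P = (\<lambda>k (m, l) n. T l m (\<sigma> k (m + n)))"
  define Q where "Q = (\<lambda>k (m, l) n. if n \<le> m then T l m (\<sigma> k (m - n)) else 0)"
  obtain r1 where r1: "\<And>K j F \<alpha>. j \<le> K \<Longrightarrow> finite F \<Longrightarrow> F \<subseteq> {r1 K..} \<Longrightarrow> \<alpha> \<in> UNIV \<times> \<Lambda> \<Longrightarrow>
       normY (\<Sum>n\<in>F. P j \<alpha> n) \<le> (1/2) ^ K / real (Suc K)"
    using uniformly_unconditionally_convergent_starts[of normY "UNIV \<times> \<Lambda>" P] plus
    unfolding P_def by blast
  obtain r2 where r2: "\<And>K j F \<alpha>. j \<le> K \<Longrightarrow> finite F \<Longrightarrow> F \<subseteq> {r2 K..} \<Longrightarrow> \<alpha> \<in> UNIV \<times> \<Lambda> \<Longrightarrow>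
       normY (\<Sum>n\<in>F. Q j \<alpha> n) \<le> (1/2) ^ K / real (Suc K)"
    using uniformly_unconditionally_convergent_starts[of normY "UNIV \<times> \<Lambda>" Q] minus
    unfolding Q_def by blast
  obtain r3 where r3: "\<And>K j F \<alpha>. j \<le> K \<Longrightarrow> finite F \<Longrightarrow> F \<subseteq> {r3 K..} \<Longrightarrow> \<alpha> \<in> {()} \<Longrightarrow>
       normX (\<Sum>n\<in>F. \<sigma> j n) \<le> (1/2) ^ K / real (Suc K)"
    using uniformly_unconditionally_convergent_starts[of normX "{()}" "\<lambda>k _. \<sigma> k"] series
    by blast
  define R where "R K = Max {r1 K, r2 K, r3 K, M K}" for K
  have R: "r1 K \<le> R K" "r2 K \<le> R K" "r3 K \<le> R K" "M K \<le> R K" for K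
    unfolding R_def by simp_all
  obtain B :: "nat set" and \<kappa> :: "nat \<Rightarrow> nat" where
    dens: "\<And>k. lower_density {n\<in>B. \<kappa> n = k} > 0" and
    start: "\<And>n. n \<in> B \<Longrightarrow> R (\<kappa> n) \<le> n" and
    sep: "\<And>m n. m \<in> B \<Longrightarrow> n \<in> B \<Longrightarrow> m < n \<Longrightarrow> R (\<kappa> m) \<le> n - m \<and> R (\<kappa> n) \<le> n - m"
    using separated_sets_of_positive_lower_density[of R] by blast
  have "\<exists>x. (\<lambda>J. \<Sum>n\<in>B \<inter> {..<J}. \<sigma> (\<kappa> n) n) \<longlonglongrightarrow> x"
  proof (rule X.unconditional_Cauchy_imp_convergent)
    fix \<epsilon> :: real assume "\<epsilon> > 0"
    then obtain K where K: "(1/2) ^ K < \<epsilon> / 2"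
      using real_arch_pow_inv[of "\<epsilon> / 2" "1/2"] by auto
    show "\<exists>n0. \<forall>F. finite F \<and> F \<subseteq> B \<inter> {n0..} \<longrightarrow> normX (\<Sum>n\<in>F. \<sigma> (\<kappa> n) n) < \<epsilon>"
    proof (intro exI allI impI)
      fix F assume F: "finite F \<and> F \<subseteq> B \<inter> {r3 K..}"
      have "r3 (\<kappa> n) \<le> n \<and> r3 K \<le> n" if "n \<in> F" for n
        using that F start[of n] R(3)[of "\<kappa> n"] by auto
      then have "normX (\<Sum>n\<in>F. \<sigma> (\<kappa> n) n) \<le> 2 * (1/2) ^ K"
        by (intro X.F_norm_superposition_le[where x = "\<lambda>k _. \<sigma> k" and h = "\<lambda>n. n" and \<kappa> = \<kappa>
              and I = "{()}" and \<alpha> = "()", OF r3])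
          (use F in auto)
      also have "\<dots> < \<epsilon>" using K by simp
      finally show "normX (\<Sum>n\<in>F. \<sigma> (\<kappa> n) n) < \<epsilon>" .
    qed
  qed
  then obtain x where x: "(\<lambda>J. \<Sum>n\<in>B \<inter> {..<J}. \<sigma> (\<kappa> n) n) \<longlonglongrightarrow> x" ..
  have shadow: "normY (T l m x - T l m (\<sigma> (\<kappa> m) m)) \<le> 4 * (1/2) ^ \<kappa> m"
    if m: "m \<in> B" and l: "l \<in> \<Lambda>" for m l
  proof (rule Y.F_norm_limit_le)
    interpret L: Vector_Spaces.linear scaleX scaleY "T l m" by (rule linear[OF l])
    show "(\<lambda>J. T l m (\<Sum>n\<in>B \<inter> {..<J}. \<sigma> (\<kappa> n) n)) \<longlonglongrightarrow> T l m x"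
      by (rule continuous_on_tendsto_compose[OF continuous[OF l] x]) auto
    have "normY (T l m (\<Sum>n\<in>B \<inter> {..<J}. \<sigma> (\<kappa> n) n) - T l m (\<sigma> (\<kappa> m) m)) \<le> 4 * (1/2) ^ \<kappa> m"
      if "m < J" for J
    proof -
      let ?y = "\<lambda>n. T l m (\<sigma> (\<kappa> n) n)"
      have "B \<inter> {..<J} = insert m (B \<inter> {..<m} \<union> B \<inter> {m<..<J})" using m that by auto
      then have "T l m (\<Sum>n\<in>B \<inter> {..<J}. \<sigma> (\<kappa> n) n)
          = sum ?y (insert m (B \<inter> {..<m} \<union> B \<inter> {m<..<J}))"
        by (simp only: L.sum)
      also have "\<dots> = ?y m + (sum ?y (B \<inter> {..<m}) + sum ?y (B \<inter> {m<..<J}))"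
        by (subst sum.insert) (auto intro!: sum.union_disjoint)
      finally have split: "T l m (\<Sum>n\<in>B \<inter> {..<J}. \<sigma> (\<kappa> n) n) - ?y m
          = sum ?y (B \<inter> {..<m}) + sum ?y (B \<inter> {m<..<J})" by simp
      have "r2 (\<kappa> n) \<le> m - n \<and> r2 (\<kappa> m) \<le> m - n" if "n \<in> B \<inter> {..<m}" for n
        using sep[of n m] R(2)[of "\<kappa> n"] R(2)[of "\<kappa> m"] that m by simp
      then have "normY (\<Sum>n\<in>B \<inter> {..<m}. Q (\<kappa> n) (m, l) (m - n)) \<le> 2 * (1/2) ^ \<kappa> m"
        by (intro Y.F_norm_superposition_le[where x = Q and h = "\<lambda>n. m - n" and \<kappa> = \<kappa>, OF r2])
          (use l in \<open>auto simp: inj_on_def\<close>)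
      moreover have "(\<Sum>n\<in>B \<inter> {..<m}. Q (\<kappa> n) (m, l) (m - n)) = sum ?y (B \<inter> {..<m})"
        by (intro sum.cong) (auto simp: Q_def)
      ultimately have before: "normY (sum ?y (B \<inter> {..<m})) \<le> 2 * (1/2) ^ \<kappa> m" by simp
      have "r1 (\<kappa> n) \<le> n - m \<and> r1 (\<kappa> m) \<le> n - m" if "n \<in> B \<inter> {m<..<J}" for n
        using sep[of m n] R(1)[of "\<kappa> n"] R(1)[of "\<kappa> m"] that m by simp
      then have "normY (\<Sum>n\<in>B \<inter> {m<..<J}. P (\<kappa> n) (m, l) (n - m)) \<le> 2 * (1/2) ^ \<kappa> m"
        by (intro Y.F_norm_superposition_le[where x = P and h = "\<lambda>n. n - m" and \<kappa> = \<kappa>, OF r1])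
          (use l in \<open>auto simp: inj_on_def\<close>)
      moreover have "(\<Sum>n\<in>B \<inter> {m<..<J}. P (\<kappa> n) (m, l) (n - m)) = sum ?y (B \<inter> {m<..<J})"
        by (intro sum.cong) (auto simp: P_def)
      ultimately have "normY (sum ?y (B \<inter> {m<..<J})) \<le> 2 * (1/2) ^ \<kappa> m" by simp
      with before show ?thesis unfolding split
        using Y.F_norm_triangle[of "sum ?y (B \<inter> {..<m})" "sum ?y (B \<inter> {m<..<J})"] by linarith
    qed
    then show "\<forall>\<^sub>F J in sequentially.
        normY (T l m (\<Sum>n\<in>B \<inter> {..<J}. \<sigma> (\<kappa> n) n) - T l m (\<sigma> (\<kappa> m) m)) \<le> 4 * (1/2) ^ \<kappa> m"
      by (intro eventually_sequentiallyI[of "Suc m"]) auto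
  qed
  have "M k \<le> n" if "n \<in> B" "\<kappa> n = k" for n k
    using start[OF that(1)] R(4)[of k] that(2) by simp
  then show ?thesis
    using dens shadow by (intro exI[of _ x] exI[of _ "\<lambda>k. {n\<in>B. \<kappa> n = k}"]) auto
qed

section \<open>Reduction to countably many tasks\<close>

theorem theorem4p2:
  fixes scaleX :: "'k::real_normed_field \<Rightarrow> 'a::{ab_group_add, topological_space} \<Rightarrow> 'a"
    and scaleY :: "'k \<Rightarrow> 'b::{ab_group_add, topological_space} \<Rightarrow> 'b"
    and normX :: "'a \<Rightarrow> real"
    and normY :: "'b \<Rightarrow> real"
    and \<Lambda> :: "(real ^ 'd) set"
    and T :: "real ^ 'd \<Rightarrow> nat \<Rightarrow> 'a \<Rightarrow> 'b"
    and S :: "real ^ 'd \<Rightarrow> nat \<Rightarrow> 'b \<Rightarrow> 'a"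
    and Y0 :: "'b set"
  assumes X: "F_space scaleX normX"
    and Y: "F_space scaleY normY"
    and Y_separable: "separable_space (euclidean :: 'b topology)"
    and bounded: "bounded \<Lambda>"
    and T_linear: "\<And>l n. l \<in> \<Lambda> \<Longrightarrow> Vector_Spaces.linear scaleX scaleY (T l n)"
    and T_continuous: "\<And>l n. l \<in> \<Lambda> \<Longrightarrow> continuous_on UNIV (T l n)"
    and Y0_dense: "closure Y0 = UNIV"
    and series_TS_plus: "\<And>u. u \<in> Y0 \<Longrightarrow>
      uniformly_unconditionally_convergent normY (UNIV \<times> \<Lambda> \<times> \<Lambda>)
        (\<lambda>(m, l, \<mu>) n. T l m (S \<mu> (m + n) u))"
    and series_TS_minus: "\<And>u. u \<in> Y0 \<Longrightarrow>
      uniformly_unconditionally_convergent normY (UNIV \<times> \<Lambda> \<times> \<Lambda>)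
        (\<lambda>(m, l, \<mu>) n. if n \<le> m then T l m (S \<mu> (m - n) u) else 0)"
    and series_S: "\<And>u. u \<in> Y0 \<Longrightarrow>
      uniformly_unconditionally_convergent normX \<Lambda> (\<lambda>l n. S l n u)"
    and TS_near_id: "\<And>u. u \<in> Y0 \<Longrightarrow>
      \<forall>\<epsilon>>0. \<exists>\<delta>>0. \<exists>M. \<forall>n\<ge>M. \<forall>l\<in>\<Lambda>. \<forall>\<mu>\<in>\<Lambda>.
        infnorm (l - \<mu>) \<le> \<delta> \<longrightarrow> normY (T l n (S \<mu> n u) - u) \<le> \<epsilon>"
  shows "\<exists>x. common_frequently_universal \<Lambda> T x"
proof (cases "\<Lambda> = {}")
  case True
  then show ?thesis by (simp add: common_frequently_universal_def)
next
  case False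
  interpret Y: F_space scaleY normY by (rule Y)
  obtain C :: "'b set" where C: "countable C" "closure C = UNIV"
    using Y_separable by (auto simp: separable_space_def)
  define d where "d = from_nat_into C"
  have "C \<noteq> {}" using C(2) by auto
  then have range_d: "range d = C" unfolding d_def by (rule range_from_nat_into) (rule C(1))
  obtain E :: "(real ^ 'd) set" where E: "countable E" "E \<subseteq> \<Lambda>" "\<Lambda> \<subseteq> closure E"
    by (rule separable)
  define \<mu> where "\<mu> = from_nat_into E"
  have "E \<noteq> {}" using E(3) False by auto
  then have range_\<mu>: "range \<mu> = E" unfolding \<mu>_def by (rule range_from_nat_into) (rule E(1))
  then have \<mu>_in: "\<mu> j \<in> \<Lambda>" for j using E(2) by auto
  have "\<exists>u\<in>Y0. normY (u - d i) < inverse (real (Suc s))" for i s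
  proof -
    let ?V = "{z. normY (z - d i) < inverse (real (Suc s))}"
    have "d i \<in> ?V" by (simp add: Y.F_norm_zero)
    then have "?V \<inter> Y0 \<noteq> {}"
      using Y0_dense Y.open_F_ball[of "d i" "inverse (real (Suc s))"]
      by (metis IntI UNIV_I empty_iff open_Int_closure_eq_empty)
    then show ?thesis by auto
  qed
  then obtain u where u_in: "\<And>i s. u i s \<in> Y0"
    and u_close: "\<And>i s. normY (u i s - d i) < inverse (real (Suc s))" by metis
  have "\<exists>\<delta> M. \<delta> > 0 \<and> (\<forall>n\<ge>M. \<forall>l\<in>\<Lambda>. \<forall>\<mu>\<in>\<Lambda>. infnorm (l - \<mu>) \<le> \<delta> \<longrightarrow>
      normY (T l n (S \<mu> n (u i s)) - u i s) \<le> inverse (real (Suc s)))" for i s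
  proof -
    have "inverse (real (Suc s)) > 0" by simp
    then show ?thesis using TS_near_id[OF u_in[of i s]] by blast
  qed
  then obtain \<delta> M where \<delta>_pos: "\<And>i s. \<delta> i s > 0" and near:
    "\<And>i s n l \<nu>. n \<ge> M i s \<Longrightarrow> l \<in> \<Lambda> \<Longrightarrow> \<nu> \<in> \<Lambda> \<Longrightarrow> infnorm (l - \<nu>) \<le> \<delta> i s \<Longrightarrow>
      normY (T l n (S \<nu> n (u i s)) - u i s) \<le> inverse (real (Suc s))"
    by metis
  \<comment> \<open>All triples \<open>(i, s, j)\<close> are enumerated by the pairing function; the only further property
    needed of this enumeration is that the triple has a number \<open>k \<ge> s\<close>.\<close>
  define task_i task_s task_j :: "nat \<Rightarrow> nat" where
    "task_i k = fst (prod_decode k)" and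
    "task_s k = fst (prod_decode (snd (prod_decode k)))" and
    "task_j k = snd (prod_decode (snd (prod_decode k)))" for k
  define \<sigma> where "\<sigma> k n = S (\<mu> (task_j k)) n (u (task_i k) (task_s k))" for k n
  have plus: "uniformly_unconditionally_convergent normY (UNIV \<times> \<Lambda>)
      (\<lambda>(m, l) n. T l m (\<sigma> k (m + n)))" for k
    by (rule uniformly_unconditionally_convergent_reindex
        [OF series_TS_plus[OF u_in[of "task_i k" "task_s k"]],
          where f = "\<lambda>(m, l). (m, l, \<mu> (task_j k))"])
      (auto simp: \<sigma>_def \<mu>_in)
  have minus: "uniformly_unconditionally_convergent normY (UNIV \<times> \<Lambda>)
      (\<lambda>(m, l) n. if n \<le> m then T l m (\<sigma> k (m - n)) else 0)" for k
    by (rule uniformly_unconditionally_convergent_reindex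
        [OF series_TS_minus[OF u_in[of "task_i k" "task_s k"]],
          where f = "\<lambda>(m, l). (m, l, \<mu> (task_j k))"])
      (auto simp: \<sigma>_def \<mu>_in)
  have series: "uniformly_unconditionally_convergent normX {()} (\<lambda>_. \<sigma> k)" for k
    by (rule uniformly_unconditionally_convergent_reindex
        [OF series_S[OF u_in[of "task_i k" "task_s k"]], where f = "\<lambda>_. \<mu> (task_j k)"])
      (auto simp: \<sigma>_def \<mu>_in)
  have "\<exists>x A. \<forall>k. lower_density (A k) > 0 \<and> (\<forall>n\<in>A k. M (task_i k) (task_s k) \<le> n \<and>
      (\<forall>l\<in>\<Lambda>. normY (T l n x - T l n (\<sigma> k n)) \<le> 4 * (1/2) ^ k))"
    by (intro exists_frequently_shadowing_vector[OF X Y] T_linear T_continuous plus minus series)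
  then obtain x A where "\<forall>k. lower_density (A k) > 0 \<and>
      (\<forall>n\<in>A k. M (task_i k) (task_s k) \<le> n \<and>
        (\<forall>l\<in>\<Lambda>. normY (T l n x - T l n (\<sigma> k n)) \<le> 4 * (1/2) ^ k))"
    by (elim exE)
  then have A_dens: "\<And>k. lower_density (A k) > 0"
    and A_start: "\<And>k n. n \<in> A k \<Longrightarrow> M (task_i k) (task_s k) \<le> n"
    and A_shadow: "\<And>k n l. n \<in> A k \<Longrightarrow> l \<in> \<Lambda> \<Longrightarrow>
      normY (T l n x - T l n (\<sigma> k n)) \<le> 4 * (1/2) ^ k"
    by blast+
  have "lower_density {n. T l n x \<in> U} > 0" if l: "l \<in> \<Lambda>" and U: "open U" "y \<in> U" for l U y
  proof -
    obtain \<rho> where "\<rho> > 0" and ball: "\<And>z. normY (z - y) < \<rho> \<Longrightarrow> z \<in> U"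
      using Y.open_contains_F_ball[OF U] by blast
    \<comment> \<open>The final error is at most \<open>4 + 1 + 1\<close> multiples of \<open>1 / (s + 1)\<close>, for the shadowing,
      for the defect of \<open>T l n (S \<mu> n u)\<close> and for \<open>u i s\<close>,
      plus the distance from \<open>d i\<close> to \<open>y\<close>: seven parts.\<close>
    let ?V = "{z. normY (z - y) < \<rho> / 7}"
    have "y \<in> ?V" using \<open>\<rho> > 0\<close> by (simp add: Y.F_norm_zero)
    then have "?V \<inter> C \<noteq> {}"
      using C(2) Y.open_F_ball[of y "\<rho> / 7"]
      by (metis IntI UNIV_I empty_iff open_Int_closure_eq_empty)
    then obtain i where i: "normY (d i - y) < \<rho> / 7" using range_d by auto
    obtain s where s: "inverse (real (Suc s)) < \<rho> / 7"
      using reals_Archimedean[of "\<rho> / 7"] \<open>\<rho> > 0\<close> by auto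
    have "l \<in> closure E" using E(3) l by blast
    then obtain j where "dist (\<mu> j) l < \<delta> i s"
      using \<delta>_pos[of i s] range_\<mu> by (metis closure_approachable imageE)
    then have j: "infnorm (l - \<mu> j) \<le> \<delta> i s"
      using infnorm_le_norm[of "l - \<mu> j"] by (simp add: dist_norm norm_minus_commute)
    define k where "k = prod_encode (i, prod_encode (s, j))"
    have k: "task_i k = i" "task_s k = s" "task_j k = j"
      by (simp_all add: k_def task_i_def task_s_def task_j_def)
    have "s \<le> k" unfolding k_def
      by (meson le_prod_encode_1 le_prod_encode_2 order_trans)
    have "(1/2) ^ k \<le> inverse (real (Suc s))"
    proof -
      have "Suc s \<le> 2 ^ k" using \<open>s \<le> k\<close> less_exp[of k] by linarith
      then have "real (Suc s) \<le> 2 ^ k" by (metis of_nat_le_iff of_nat_numeral of_nat_power)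
      then show ?thesis by (simp add: power_one_over inverse_eq_divide frac_le del: of_nat_Suc)
    qed
    have "T l n x \<in> U" if n: "n \<in> A k" for n
    proof (rule ball)
      let ?w = "T l n (\<sigma> k n)"
      have 1: "normY (T l n x - ?w) \<le> 4 * (1/2) ^ k" using A_shadow[OF n l] .
      have 2: "normY (?w - u i s) \<le> inverse (real (Suc s))"
        using near[OF _ l \<mu>_in j, of n] A_start[OF n] by (simp add: \<sigma>_def k)
      have "normY (T l n x - y) \<le> normY (T l n x - ?w) + normY (?w - u i s)
          + normY (u i s - d i) + normY (d i - y)"
        using Y.triangle[of "T l n x" ?w y] Y.triangle[of ?w "u i s" y]
          Y.triangle[of "u i s" "d i" y] by simp
      also have "\<dots> < \<rho>"
        using 1 2 u_close[of i s] i s \<open>(1/2) ^ k \<le> inverse (real (Suc s))\<close> by linarith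
      finally show "normY (T l n x - y) < \<rho>" .
    qed
    then have "lower_density (A k) \<le> lower_density {n. T l n x \<in> U}"
      by (intro lower_density_mono) auto
    with A_dens[of k] show ?thesis by (rule less_le_trans)
  qed
  then show ?thesis
    unfolding common_frequently_universal_def frequently_universal_def by blast
qed

end
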